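(* Let $\alpha,\beta,r$ be complex numbers with $\beta\neq 0$, let $n\ge0$ be an integer, and let $s\geq 0$, $0<x<1$, $0<a<1$ be real. Then $$\frac{1}{(1+x)^{s+1}}\,w_{n}^{(s+1)}\left(\frac{-x}{1+x};\alpha,\beta,r\right)=\frac{1}{2\pi i\,\Gamma(s+1)}\int_{a-i\infty}^{a+i\infty}(r-\beta t\mid\alpha)_{n}\,x^{-t}\,\Gamma(t)\,\Gamma(s+1-t)\,dt.$$
   Context: The generalized factorial with increment $\alpha$ is $(z\mid\alpha)_0=1$, $(z\mid\alpha)_n=z(z-\alpha)\cdots(z-n\alpha+\alpha)$. The generalized Stirling numbers $S(n,k;\alpha,\beta,r)$ are characterised by: for every $n$-times differentiable $f$ on $(0,\infty)$, with $D=d/dx$, $$\left(\beta x^{1-\alpha/\beta}D\right)^{n}\left[x^{r/\beta}f(x)\right]=x^{(r-n\alpha)/\beta}\sum_{k=0}^{n}S(n,k;\alpha,\beta,r)\beta^{k}x^{k}f^{(k)}(x);$$ equivalently, by the formal power series identity $$\left(\frac{(1+\alpha t)^{\beta/\alpha}-1}{\beta}\right)^{k}(1+\alpha t)^{r/\alpha}=k!\sum_{n=0}^{\infty}S(n,k;\alpha,\beta,r)\frac{t^{n}}{n!},$$ where $(1+\alpha t)^{c/\alpha}$ is interpreted as $e^{ct}$ when $\alpha=0$. The higher order generalized geometric polynomials are $$w_{n}^{(s+1)}(x;\alpha,\beta,r)=\sum_{k=0}^{n}S(n,k;\alpha,\beta,r)\langle s+1\rangle_{k}\,\beta^{k}x^{k},$$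 with rising factorial $\langle y\rangle_{0}=1$, $\langle y\rangle_{k}=y(y+1)\cdots(y+k-1)$. *)

theory Defs
  imports "HOL-Analysis.Analysis"
begin

definition gen_factorial :: "complex \<Rightarrow> complex \<Rightarrow> nat \<Rightarrow> complex" where
  "gen_factorial z \<alpha> n = (\<Prod>i<n. z - of_nat i * \<alpha>)"

(* The formal power series (1 + \<alpha> t)^(c/\<alpha>), read as exp(c t) when \<alpha> = 0. *)
definition fps_gen_power :: "complex \<Rightarrow> complex \<Rightarrow> complex fps" where
  "fps_gen_power \<alpha> c =
     (if \<alpha> = 0 then fps_exp c
      else fps_binomial (c / \<alpha>) oo (fps_const \<alpha> * fps_X))"

(* S(n,k;\<alpha>,\<beta>,r), read off from its exponential generating function in n
   (see gen_stirling_egf); meaningful for \<beta> \<noteq> 0 only. *)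
definition gen_stirling ::
    "nat \<Rightarrow> nat \<Rightarrow> complex \<Rightarrow> complex \<Rightarrow> complex \<Rightarrow> complex" where
  "gen_stirling n k \<alpha> \<beta> r =
     fact n / fact k *
     fps_nth ((fps_const (1 / \<beta>) * (fps_gen_power \<alpha> \<beta> - 1)) ^ k * fps_gen_power \<alpha> r) n"

lemma gen_stirling_egf:
  "(fps_const (1 / \<beta>) * (fps_gen_power \<alpha> \<beta> - 1)) ^ k * fps_gen_power \<alpha> r =
   fps_const (fact k) * Abs_fps (\<lambda>n. gen_stirling n k \<alpha> \<beta> r / fact n)"
  by (rule fps_ext) (simp add: gen_stirling_def)

(* The parameter p is the upper index of w, i.e. p = s + 1 for w_n^(s+1);
   the rising factorial is the library's pochhammer. *)
definition gen_geom_poly ::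
    "nat \<Rightarrow> complex \<Rightarrow> complex \<Rightarrow> complex \<Rightarrow> complex \<Rightarrow> complex \<Rightarrow> complex" where
  "gen_geom_poly n p x \<alpha> \<beta> r =
     (\<Sum>k\<le>n. gen_stirling n k \<alpha> \<beta> r * pochhammer p k * \<beta> ^ k * x ^ k)"

(* The integral of f along the line from a - i\<infinity> to a + i\<infinity>, parametrised by
   t = a + i y with dt = i dy, as an absolutely convergent Lebesgue integral.
   vertical_integral is only meaningful together with vertical_integrable. *)
definition vertical_integrable :: "real \<Rightarrow> (complex \<Rightarrow> complex) \<Rightarrow> bool" where
  "vertical_integrable a f \<longleftrightarrow> integrable lborel (\<lambda>y::real. f (Complex a y))"

definition vertical_integral :: "real \<Rightarrow> (complex \<Rightarrow> complex) \<Rightarrow> complex" where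
  "vertical_integral a f = \<i> * (LINT y|lborel. f (Complex a y))"

end

(* The generating function of the generalized Stirling numbers gives the Newton type expansion
     (r - \<beta> t | \<alpha>)_n = sum_k S(n,k) (-\<beta>)^k t (t+1) ... (t+k-1),
   and t (t+1) ... (t+k-1) Gamma(t) = Gamma(t+k), so the integral is a combination of the integrals of
   x^(-t) Gamma(t+k) Gamma(s+1-t), each of which equals
   2 \<pi> i x^k Gamma(s+1+k) (1+x)^(-s-1-k). To evaluate these, substitute u = e^v in Euler's integral:
   y \<mapsto> Gamma(c+iy) is the Fourier transform of exp(c v - e^v). Fourier inversion gives the
   Cahen-Mellin integral, that is, e^(-x) as an inverse Mellin transform of Gamma, and
   Fubini's theorem then turns it into the integral with two Gamma factors. *)
theory Submission
  imports Defs "HOL-Probability.Characteristic_Functions" "HOL-Probability.Sinc_Integral"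
begin

section \<open>Newton type expansion with generalized Stirling numbers\<close>

text \<open>Removes the case distinction on \<alpha>: for \<alpha> = 0 the generalized factorial is
  a plain power, as in the exponential series, and otherwise the \<alpha>^n produced by substituting
  \<alpha> t is absorbed into the falling product of z/\<alpha>.\<close>

lemma fps_gen_power_nth: "fps_nth (fps_gen_power \<alpha> z) n = gen_factorial z \<alpha> n / fact n"
proof (cases "\<alpha> = 0")
  case True
  then show ?thesis by (simp add: fps_gen_power_def gen_factorial_def)
next
  case False
  have "\<alpha> ^ n * (\<Prod>i<n. z / \<alpha> - of_nat i) = (\<Prod>i<n. \<alpha> * (z / \<alpha> - of_nat i))"
    by (simp add: prod.distrib)
  also have "\<dots> = gen_factorial z \<alpha> n"
    using False by (simp add: gen_factorial_def right_diff_distrib mult.commute)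
  finally show ?thesis
    using False
    by (simp add: fps_gen_power_def fps_compose_linear gbinomial_prod_rev lessThan_atLeast0)
qed

lemma fps_gen_power_add:
  "fps_gen_power \<alpha> (c + d) = fps_gen_power \<alpha> c * fps_gen_power \<alpha> d"
  by (simp add: fps_gen_power_def fps_exp_add_mult fps_binomial_add_mult add_divide_distrib
      fps_compose_mult_distrib)

lemma fps_gen_power_of_nat_mult:
  "fps_gen_power \<alpha> (c * of_nat m) = fps_gen_power \<alpha> c ^ m"
proof (induction m)
  case 0
  then show ?case by (simp add: fps_gen_power_def)
next
  case (Suc m)
  then show ?case by (simp add: fps_gen_power_add distrib_left)
qed

text \<open>The series raised to the power k has no constant term, so its k-th power starts in
  degree k or later.\<close>

lemma gen_stirling_eq_0:
  assumes "n < k"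
  shows "gen_stirling n k \<alpha> \<beta> r = 0"
proof -
  define Y where "Y = fps_const (1 / \<beta>) * (fps_gen_power \<alpha> \<beta> - 1)"
  have "fps_nth Y 0 = 0"
    by (simp add: Y_def fps_gen_power_nth gen_factorial_def)
  then have "fps_nth (Y ^ k) i = 0" if "i \<le> n" for i
    using startsby_zero_power_prefix[of Y k] that assms by simp
  then show ?thesis
    unfolding gen_stirling_def Y_def[symmetric] by (simp add: fps_mult_nth)
qed

text \<open>Shifting the exponent by \<beta> m multiplies the series by (1 + \<beta> Y)^m, where Y
  is the series whose powers generate the Stirling numbers. Expand by the binomial theorem and
  compare coefficients of degree n.\<close>

lemma gen_factorial_add_of_nat_mult:
  assumes "\<beta> \<noteq> 0"
  shows "gen_factorial (r + \<beta> * of_nat m) \<alpha> n =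
    (\<Sum>k\<le>n. gen_stirling n k \<alpha> \<beta> r * \<beta> ^ k * fact k * (of_nat m gchoose k))"
proof -
  define Y where "Y = fps_const (1 / \<beta>) * (fps_gen_power \<alpha> \<beta> - 1)"
  define f where "f k = gen_stirling n k \<alpha> \<beta> r * \<beta> ^ k * fact k * (of_nat m gchoose k)" for k
  have "fps_const \<beta> * Y = fps_gen_power \<alpha> \<beta> - 1"
    using assms unfolding Y_def mult.assoc[symmetric] fps_const_mult by simp
  then have "fps_gen_power \<alpha> (r + \<beta> * of_nat m) = (fps_const \<beta> * Y + 1) ^ m * fps_gen_power \<alpha> r"
    by (simp add: fps_gen_power_add fps_gen_power_of_nat_mult mult.commute)
  also have "\<dots> = (\<Sum>k\<le>m. of_nat (m choose k) * (fps_const \<beta> * Y) ^ k * fps_gen_power \<alpha> r)"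
    by (simp add: binomial_ring sum_distrib_right)
  also have "\<dots> = (\<Sum>k\<le>m. fps_const (of_nat (m choose k) * \<beta> ^ k) * (Y ^ k * fps_gen_power \<alpha> r))"
    by (simp add: power_mult_distrib fps_const_power fps_of_nat[symmetric] fps_const_mult[symmetric]
        mult_ac del: fps_const_mult)
  finally have "gen_factorial (r + \<beta> * of_nat m) \<alpha> n / fact n =
      (\<Sum>k\<le>m. of_nat (m choose k) * \<beta> ^ k * fps_nth (Y ^ k * fps_gen_power \<alpha> r) n)"
    by (simp add: fps_gen_power_nth[symmetric] fps_sum_nth)
  then have "gen_factorial (r + \<beta> * of_nat m) \<alpha> n = (\<Sum>k\<le>m. f k)"
    by (simp add: field_simps f_def gen_stirling_def Y_def[symmetric] binomial_gbinomial
        sum_distrib_left)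
  \<comment> \<open>The upper limit changes from m to n by way of m + n: the binomial coefficient
    vanishes for k > m, the Stirling number for k > n.\<close>
  also have "\<dots> = (\<Sum>k\<le>m + n. f k)"
    by (rule sum.mono_neutral_left) (auto simp: f_def binomial_gbinomial[symmetric])
  also have "\<dots> = (\<Sum>k\<le>n. f k)"
    by (rule sum.mono_neutral_right) (auto simp: f_def gen_stirling_eq_0)
  finally show ?thesis
    unfolding f_def .
qed

text \<open>Both sides are polynomials in \<open>t\<close>, and they agree at all \<open>t = - m\<close> with \<open>m\<close> natural.\<close>
lemma gen_factorial_eq_sum_pochhammer:
  assumes "\<beta> \<noteq> 0"
  shows "gen_factorial (r - \<beta> * t) \<alpha> n =
    (\<Sum>k\<le>n. gen_stirling n k \<alpha> \<beta> r * (- \<beta>) ^ k * pochhammer t k)"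
proof -
  define p where "p = (\<Prod>i<n. [:r - of_nat i * \<alpha>, \<beta>:])"
  define q where "q = (\<Sum>k\<le>n. smult (gen_stirling n k \<alpha> \<beta> r * \<beta> ^ k) (\<Prod>i<k. [:- of_nat i, 1:]))"
  have p: "poly p u = gen_factorial (r + \<beta> * u) \<alpha> n" for u
    by (simp add: p_def gen_factorial_def poly_prod algebra_simps)
  have q: "poly q u = (\<Sum>k\<le>n. gen_stirling n k \<alpha> \<beta> r * \<beta> ^ k * (\<Prod>i<k. u - of_nat i))" for u
    by (simp add: q_def poly_sum poly_prod)
  have "range of_nat \<subseteq> {u. poly (p - q) u = 0}"
    by (auto simp: p q gen_factorial_add_of_nat_mult[OF assms] gbinomial_prod_rev
        lessThan_atLeast0 mult.assoc)
  moreover have "infinite (range (of_nat :: nat \<Rightarrow> complex))"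
    by (rule range_inj_infinite) (simp add: inj_def)
  ultimately have "p - q = 0"
    using poly_roots_finite finite_subset by blast
  then have "gen_factorial (r - \<beta> * t) \<alpha> n = poly q (- t)"
    using p[of "- t"] by simp
  \<comment> \<open>The falling factorial at -t is the rising one at t up to (-1)^k, which turns
    \<beta>^k into (-\<beta>)^k.\<close>
  moreover have "(\<Prod>i<k. - t - of_nat i) = (- 1) ^ k * pochhammer t k" for k
  proof -
    have "(\<Prod>i<k. - t - of_nat i) = (\<Prod>i<k. (- 1) * (t + of_nat i))"
      by simp
    also have "\<dots> = (- 1) ^ k * (\<Prod>i<k. t + of_nat i)"
      unfolding prod.distrib by simp
    finally show ?thesis
      by (simp add: pochhammer_prod lessThan_atLeast0)
  qed
  ultimately show ?thesis
    by (simp add: q power_minus[of \<beta>] mult_ac)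
qed

section \<open>Fourier inversion on the real line\<close>

lemma integrable_lborel_pair_bound:
  fixes f g :: "real \<Rightarrow> complex" and h :: "real \<times> real \<Rightarrow> complex"
  assumes f: "integrable lborel f" and g: "integrable lborel g"
    and h: "h \<in> borel_measurable (lborel \<Otimes>\<^sub>M lborel)"
    and le: "\<And>s t. norm (h (s, t)) \<le> norm (f s) * norm (g t)"
  shows "integrable (lborel \<Otimes>\<^sub>M lborel) h"
proof (rule Bochner_Integration.integrable_bound)
  have [measurable]: "f \<in> borel_measurable lborel" "g \<in> borel_measurable lborel"
    using f g by auto
  show "integrable (lborel \<Otimes>\<^sub>M lborel) (\<lambda>p. f (fst p) * g (snd p))"
  proof (rule lborel_pair.Fubini_integrable)
    show "integrable lborel (\<lambda>s. LINT t|lborel. norm (f (fst (s, t)) * g (snd (s, t))))"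
      using f by (simp add: norm_mult)
    show "AE s in lborel. integrable lborel (\<lambda>t. f (fst (s, t)) * g (snd (s, t)))"
      using g by simp
  qed measurable
  show "AE p in lborel \<Otimes>\<^sub>M lborel. norm (h p) \<le> norm (f (fst p) * g (snd p))"
    using le by (auto simp: norm_mult)
qed (fact h)

lemma has_bochner_integral_std_normal_iexp:
  "has_bochner_integral lborel (\<lambda>w. std_normal_density w *\<^sub>R iexp (t * w))
     (complex_of_real (exp (- (t\<^sup>2) / 2)))"
proof -
  have "integrable lborel (\<lambda>w. std_normal_density w *\<^sub>R iexp (t * w))"
    by (rule Bochner_Integration.integrable_bound[OF integrable_std_normal_moment[of 0]])
       (auto simp: normal_density_nonneg)
  moreover have "(LINT w|lborel. std_normal_density w *\<^sub>R iexp (t * w)) = char std_normal_distribution t"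
    unfolding char_def by (subst integral_density) (auto simp: normal_density_nonneg)
  ultimately show ?thesis
    by (simp add: has_bochner_integral_iff char_std_normal_distribution)
qed

text \<open>A Gaussian is its own Fourier transform up to scaling. As a function of y the value is 2
  pi times the density of a normal variable of standard deviation \<epsilon>; the 2 pi of the
  inversion formula originates here.\<close>

lemma integral_Gaussian_iexp:
  assumes "\<epsilon> > 0"
  shows "integrable lborel (\<lambda>t. complex_of_real (exp (- ((\<epsilon> * t)\<^sup>2) / 2)))"
    and "(LINT t|lborel. iexp (t * y) * complex_of_real (exp (- ((\<epsilon> * t)\<^sup>2) / 2)))
         = of_real (2 * pi / \<epsilon> * std_normal_density (y / \<epsilon>))"
proof -
  \<comment> \<open>Substitute w = \<epsilon> t; the frequency z / \<epsilon> compensates the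
    scaling, so the exponential stays at frequency z in t.\<close>
  have *: "has_bochner_integral lborel
      (\<lambda>t. std_normal_density (\<epsilon> * t) *\<^sub>R iexp (z / \<epsilon> * (\<epsilon> * t)))
      (complex_of_real (exp (- ((z / \<epsilon>)\<^sup>2) / 2)) /\<^sub>R \<epsilon>)" for z
    using lborel_has_bochner_integral_real_affine_iff[of \<epsilon>
        "\<lambda>w. std_normal_density w *\<^sub>R iexp (z / \<epsilon> * w)" _ 0]
      has_bochner_integral_std_normal_iexp[of "z / \<epsilon>"] assms by simp
  have **: "has_bochner_integral lborel
      (\<lambda>t. iexp (t * z) * complex_of_real (exp (- ((\<epsilon> * t)\<^sup>2) / 2)))
      (of_real (2 * pi / \<epsilon> * std_normal_density (z / \<epsilon>)))" for z
  proof -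
    have "has_bochner_integral lborel
      (\<lambda>t. of_real (sqrt (2 * pi)) * (std_normal_density (\<epsilon> * t) *\<^sub>R iexp (z / \<epsilon> * (\<epsilon> * t))))
      (of_real (sqrt (2 * pi)) * (complex_of_real (exp (- ((z / \<epsilon>)\<^sup>2) / 2)) /\<^sub>R \<epsilon>))"
      by (intro has_bochner_integral_mult_right *)
    moreover have "sqrt (2 * pi) * (exp (- ((z / \<epsilon>)\<^sup>2) / 2) / \<epsilon>)
        = 2 * pi / \<epsilon> * std_normal_density (z / \<epsilon>)"
      using assms real_sqrt_mult_self[of "2 * pi"]
      by (simp add: std_normal_density_def field_simps del: real_sqrt_mult_self)
    ultimately have "has_bochner_integral lborel
      (\<lambda>t. of_real (sqrt (2 * pi)) * (std_normal_density (\<epsilon> * t) *\<^sub>R iexp (z / \<epsilon> * (\<epsilon> * t))))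
      (of_real (2 * pi / \<epsilon> * std_normal_density (z / \<epsilon>)))"
      by (simp only: scaleR_conv_of_real of_real_mult[symmetric] divide_inverse mult_ac)
    moreover have "of_real (sqrt (2 * pi)) * (std_normal_density (\<epsilon> * t) *\<^sub>R iexp (z / \<epsilon> * (\<epsilon> * t)))
       = iexp (t * z) * complex_of_real (exp (- ((\<epsilon> * t)\<^sup>2) / 2))" for t
      using assms by (simp add: std_normal_density_def scaleR_conv_of_real mult_ac)
    ultimately show ?thesis by simp
  qed
  \<comment> \<open>At frequency 0 the exponential is 1 and the bare Gaussian remains.\<close>
  from **[of 0] show "integrable lborel (\<lambda>t. complex_of_real (exp (- ((\<epsilon> * t)\<^sup>2) / 2)))"
    by (simp add: has_bochner_integral_iff)
  from **[of y] show "(LINT t|lborel. iexp (t * y) * complex_of_real (exp (- ((\<epsilon> * t)\<^sup>2) / 2)))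
         = of_real (2 * pi / \<epsilon> * std_normal_density (y / \<epsilon>))"
    by (simp add: has_bochner_integral_iff)
qed

text \<open>Damping \<open>\<phi>\<close> by the Gaussian \<open>exp (- (\<epsilon> t)\<^sup>2 / 2)\<close> replaces \<open>g x\<close> by the average of
  \<open>g (x + \<epsilon> w)\<close> over a standard normal \<open>w\<close>; then let \<open>\<epsilon>\<close> tend to 0.\<close>
lemma Fourier_inversion:
  fixes g \<phi> :: "real \<Rightarrow> complex"
  assumes g: "integrable lborel g" and bound: "\<And>v. norm (g v) \<le> B" and cont: "isCont g x"
    and \<phi>_eq: "\<And>t. \<phi> t = (LINT v|lborel. g v * iexp (t * v))" and \<phi>: "integrable lborel \<phi>"
  shows "(LINT t|lborel. \<phi> t * iexp (- (t * x))) = 2 * of_real pi * g x"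
proof -
  have [measurable]: "g \<in> borel_measurable borel" "\<phi> \<in> borel_measurable borel"
    using g \<phi> by auto
  let ?G = "\<lambda>\<epsilon> t. complex_of_real (exp (- ((\<epsilon> * t)\<^sup>2) / 2))"
  define \<epsilon> where "\<epsilon> n = 1 / real (Suc n)" for n
  have \<epsilon>_pos: "\<epsilon> n > 0" for n
    by (simp add: \<epsilon>_def)
  have \<epsilon>_lim: "\<epsilon> \<longlonglongrightarrow> 0"
    unfolding \<epsilon>_def using LIMSEQ_inverse_real_of_nat by (simp add: inverse_eq_divide)
  have smoothed: "(LINT t|lborel. \<phi> t * iexp (- (t * x)) * ?G e t)
      = 2 * of_real pi * (LINT w|lborel. std_normal_density w *\<^sub>R g (x + e * w))" if "e > 0" for e
  proof -
    have "(LINT t|lborel. \<phi> t * iexp (- (t * x)) * ?G e t)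
        = (LINT t|lborel. LINT v|lborel. g v * (iexp (t * (v - x)) * ?G e t))"
    proof (rule Bochner_Integration.integral_cong)
      fix t
      have "\<phi> t * iexp (- (t * x)) * ?G e t
          = (LINT v|lborel. g v * iexp (t * v) * (iexp (- (t * x)) * ?G e t))"
        by (subst integral_mult_left_zero) (simp add: \<phi>_eq mult.assoc)
      also have "\<dots> = (LINT v|lborel. g v * (iexp (t * (v - x)) * ?G e t))"
        by (rule Bochner_Integration.integral_cong)
           (simp_all add: exp_add[symmetric] right_diff_distrib exp_diff exp_minus field_simps)
      finally show "\<phi> t * iexp (- (t * x)) * ?G e t
          = (LINT v|lborel. g v * (iexp (t * (v - x)) * ?G e t))" .
    qed simp
    \<comment> \<open>The damping is what permits the exchange: the integrand is bounded by |g v|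
      times the Gaussian in t, a product of integrable functions.\<close>
    also have "\<dots> = (LINT v|lborel. LINT t|lborel. g v * (iexp (t * (v - x)) * ?G e t))"
    proof (rule lborel_pair.Fubini_integral,
        rule integrable_lborel_pair_bound[OF g integral_Gaussian_iexp(1)[OF that]])
      show "(\<lambda>(v, t). g v * (iexp (t * (v - x)) * ?G e t)) \<in> borel_measurable (lborel \<Otimes>\<^sub>M lborel)"
        by measurable
    qed (simp add: norm_mult)
    also have "\<dots> = (LINT v|lborel. g v * of_real (2 * pi / e * std_normal_density ((v - x) / e)))"
      by (simp only: integral_mult_right_zero integral_Gaussian_iexp(2)[OF that])
    also have "\<dots> = e *\<^sub>R (LINT w|lborel. g (x + e * w) *
        of_real (2 * pi / e * std_normal_density ((x + e * w - x) / e)))"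
      using that by (subst lborel_integral_real_affine[of e _ x]) auto
    also have "\<dots> = (LINT w|lborel. 2 * of_real pi * (std_normal_density w *\<^sub>R g (x + e * w)))"
      using that unfolding integral_scaleR_right[symmetric]
      by (intro Bochner_Integration.integral_cong) (auto simp: scaleR_conv_of_real)
    finally show ?thesis
      by (simp only: integral_mult_right_zero)
  qed
  have damped: "(\<lambda>n. LINT t|lborel. \<phi> t * iexp (- (t * x)) * ?G (\<epsilon> n) t)
      \<longlonglongrightarrow> (LINT t|lborel. \<phi> t * iexp (- (t * x)))"
  proof (rule integral_dominated_convergence)
    show "integrable lborel (\<lambda>t. norm (\<phi> t))"
      using \<phi> by simp
    show "AE t in lborel. (\<lambda>n. \<phi> t * iexp (- (t * x)) * ?G (\<epsilon> n) t) \<longlonglongrightarrow> \<phi> t * iexp (- (t * x))"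
    proof (rule AE_I2)
      fix t
      have "(\<lambda>n. \<phi> t * iexp (- (t * x)) * ?G (\<epsilon> n) t) \<longlonglongrightarrow> \<phi> t * iexp (- (t * x)) * ?G 0 t"
        by (intro tendsto_intros \<epsilon>_lim) simp
      then show "(\<lambda>n. \<phi> t * iexp (- (t * x)) * ?G (\<epsilon> n) t) \<longlonglongrightarrow> \<phi> t * iexp (- (t * x))"
        by simp
    qed
    show "AE t in lborel. norm (\<phi> t * iexp (- (t * x)) * ?G (\<epsilon> n) t) \<le> norm (\<phi> t)" for n
      by (auto simp: norm_mult intro!: mult_left_le)
  qed measurable
  have averaged: "(\<lambda>n. LINT w|lborel. std_normal_density w *\<^sub>R g (x + \<epsilon> n * w))
      \<longlonglongrightarrow> (LINT w|lborel. std_normal_density w *\<^sub>R g x)"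
  proof (rule integral_dominated_convergence)
    show "integrable lborel (\<lambda>w. std_normal_density w * B)"
      using integrable_std_normal_moment[of 0] by simp
    show "AE w in lborel. (\<lambda>n. std_normal_density w *\<^sub>R g (x + \<epsilon> n * w))
        \<longlonglongrightarrow> std_normal_density w *\<^sub>R g x"
    proof (rule AE_I2)
      fix w
      have "(\<lambda>n. x + \<epsilon> n * w) \<longlonglongrightarrow> x + 0 * w"
        by (intro tendsto_intros \<epsilon>_lim)
      then have "(\<lambda>n. g (x + \<epsilon> n * w)) \<longlonglongrightarrow> g x"
        using isCont_tendsto_compose[OF cont] by simp
      then show "(\<lambda>n. std_normal_density w *\<^sub>R g (x + \<epsilon> n * w)) \<longlonglongrightarrow> std_normal_density w *\<^sub>R g x"
        by (intro tendsto_intros)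
    qed
    show "AE w in lborel. norm (std_normal_density w *\<^sub>R g (x + \<epsilon> n * w)) \<le> std_normal_density w * B" for n
      using bound by (auto simp: normal_density_nonneg intro!: mult_left_mono)
  qed measurable
  \<comment> \<open>Frequency 0 again: the normal density has total mass 1.\<close>
  have "(LINT w|lborel. std_normal_density w *\<^sub>R g x) = g x"
    using has_bochner_integral_std_normal_iexp[of 0]
    by (simp add: has_bochner_integral_iff scaleR_conv_of_real)
  then show ?thesis
    using LIMSEQ_unique[OF damped[unfolded smoothed[OF \<epsilon>_pos]] tendsto_mult_left[OF averaged]]
    by (simp only:)
qed

section \<open>Euler's integral and the Gamma function on vertical lines\<close>

lemma has_bochner_integral_Gamma_exp:
  assumes z: "Re z > 0"
  shows "has_bochner_integral lborel (\<lambda>v. exp (z * of_real v - of_real (exp v))) (Gamma z)"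
proof -
  let ?f = "\<lambda>t. complex_of_real t powr (z - 1) / of_real (exp t)"
  let ?h = "\<lambda>v. exp (z * of_real v - of_real (exp v))"
  have "range exp = {0 :: real<..}"
    by (auto simp: image_iff intro: exp_ln[symmetric])
  then have "?f absolutely_integrable_on range exp \<and> integral (range exp) ?f = Gamma z"
    using absolutely_integrable_Gamma_integral'[OF z] integral_unique[OF Gamma_integral_complex'[OF z]]
    by simp
  then have "(\<lambda>v. \<bar>exp v\<bar> *\<^sub>R ?f (exp v)) absolutely_integrable_on UNIV \<and>
      integral UNIV (\<lambda>v. \<bar>exp v\<bar> *\<^sub>R ?f (exp v)) = Gamma z"
    by (subst has_absolute_integral_change_of_variables_real)
       (auto intro!: derivative_eq_intros simp: inj_on_def)
  moreover have "\<bar>exp v\<bar> *\<^sub>R ?f (exp v) = ?h v" for v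
  proof -
    have "complex_of_real (exp v) powr (z - 1) = exp ((z - 1) * of_real v)"
      by (simp add: powr_def Ln_of_real del: of_real_exp)
    then have "\<bar>exp v\<bar> *\<^sub>R ?f (exp v) = exp (of_real v + (z - 1) * of_real v - of_real (exp v))"
      by (simp add: scaleR_conv_of_real exp_add exp_diff exp_of_real)
    then show ?thesis
      by (simp add: algebra_simps)
  qed
  ultimately have *: "?h absolutely_integrable_on UNIV" "integral UNIV ?h = Gamma z"
    by simp_all
  have meas: "?h \<in> borel_measurable lborel"
    by measurable
  \<comment> \<open>Absolute integrability refers to the completed measure; Borel measurability
    brings it down to \<open>lborel\<close>.\<close>
  have int: "integrable lborel ?h"
    using *(1) meas by (simp add: set_integrable_def integrable_completion)
  moreover from int have "integral\<^sup>L lborel ?h = Gamma z"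
    using *(2) integral_lborel[of ?h] by simp
  ultimately show ?thesis
    by (simp add: has_bochner_integral_iff)
qed

text \<open>The translation v \<mapsto> v + ln L turns e^v into L e^v and produces the constant e^(p
  ln L), which is moved to the other side.\<close>

lemma has_bochner_integral_Gamma_exp_scaled:
  assumes p: "p > 0" and L: "L > 0"
  shows "has_bochner_integral lborel (\<lambda>v. complex_of_real (exp (p * v - L * exp v)))
    (of_real (Gamma p * L powr (- p)))"
proof -
  have "has_bochner_integral lborel
     (\<lambda>v. exp (complex_of_real p * of_real (ln L + 1 * v) - of_real (exp (ln L + 1 * v)))) (Gamma (complex_of_real p))"
    using lborel_has_bochner_integral_real_affine_iff[of 1
        "\<lambda>v. exp (complex_of_real p * of_real v - of_real (exp v))" "Gamma (of_real p)" "ln L"]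
      has_bochner_integral_Gamma_exp[of "of_real p"] p
    by (simp del: of_real_exp of_real_add)
  then have "has_bochner_integral lborel
     (\<lambda>v. of_real (L powr (- p)) *
       exp (complex_of_real p * of_real (ln L + 1 * v) - of_real (exp (ln L + 1 * v))))
     (of_real (L powr (- p)) * Gamma (complex_of_real p))"
    by (intro has_bochner_integral_mult_right)
  moreover have "of_real (L powr (- p)) *
       exp (complex_of_real p * of_real (ln L + 1 * v) - of_real (exp (ln L + 1 * v)))
      = of_real (exp (p * v - L * exp v))" for v
  proof -
    have "exp (complex_of_real p * of_real (ln L + 1 * v) - of_real (exp (ln L + 1 * v)))
      = of_real (exp (p * (ln L + 1 * v) - exp (ln L + 1 * v)))"
      by (simp only: of_real_exp of_real_diff of_real_mult)
    moreover have "L powr (- p) * exp (p * (ln L + 1 * v) - exp (ln L + 1 * v)) = exp (p * v - L * exp v)"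
      using L by (simp add: powr_def exp_add[symmetric] algebra_simps) (simp add: exp_add)
    ultimately show ?thesis
      by (simp only: of_real_mult[symmetric])
  qed
  ultimately show ?thesis
    by (simp add: Gamma_complex_of_real mult.commute)
qed

text \<open>In Euler's integral the modulus of the integrand depends only on the real part of the
  argument.\<close>

lemma norm_Gamma_Complex_bounded:
  assumes "c > 0"
  obtains B where "B \<ge> 0" and "\<And>y. norm (Gamma (Complex c y)) \<le> B"
proof
  let ?B = "LINT v|lborel. exp (c * v - exp v)"
  show "?B \<ge> 0"
    by simp
  fix y
  have "norm (exp (Complex c y * of_real v - of_real (exp v))) = exp (c * v - exp v)" for v
    by (simp add: norm_exp_eq_Re del: of_real_exp)
  then show "norm (Gamma (Complex c y)) \<le> ?B"
    using has_bochner_integral_Gamma_exp[of "Complex c y"] assms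
      integral_norm_bound[of lborel "\<lambda>v. exp (Complex c y * of_real v - of_real (exp v))"]
    by (simp add: has_bochner_integral_iff del: of_real_exp)
qed

lemma Complex_notin_nonpos_Ints:
  assumes "c > 0"
  shows "Complex c y \<notin> \<int>\<^sub>\<le>\<^sub>0"
  using assms by (auto elim!: nonpos_Ints_cases simp: complex_eq_iff)

lemma borel_measurable_Gamma_Complex:
  assumes "c > 0"
  shows "(\<lambda>y. Gamma (Complex c y)) \<in> borel_measurable borel"
proof (rule borel_measurable_continuous_onI)
  have "continuous_on UNIV (\<lambda>y. Complex c y)"
    unfolding Complex_eq by (intro continuous_intros)
  then show "continuous_on UNIV (\<lambda>y. Gamma (Complex c y))"
    using Complex_notin_nonpos_Ints[OF assms]
    by (intro continuous_on_compose2[OF continuous_on_Gamma[of "- \<int>\<^sub>\<le>\<^sub>0"]]) auto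
qed

text \<open>Shifting the argument by two turns boundedness on vertical lines into quadratic decay.\<close>
lemma integrable_Gamma_Complex:
  assumes c: "c > 0"
  shows "integrable lborel (\<lambda>y. Gamma (Complex c y))"
proof -
  obtain B where B: "B \<ge> 0" "\<And>y. norm (Gamma (Complex (c + 2) y)) \<le> B"
    using norm_Gamma_Complex_bounded[of "c + 2"] c by auto
  \<comment> \<open>For z = c + i y one has |z + 1| |z| \<ge> |z|^2 = c^2 + y^2, and this m makes m
    (1 + y^2) a lower bound of the right side.\<close>
  define m where "m = min (c\<^sup>2) 1"
  have m: "m > 0"
    using c by (simp add: m_def)
  show ?thesis
  proof (rule Bochner_Integration.integrable_bound)
    show "integrable lborel (\<lambda>y. B / m * inverse (1 + y\<^sup>2))"
      using integrable_inverse_1_plus_square by (simp add: set_integrable_def einterval_eq)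
    show "AE y in lborel. norm (Gamma (Complex c y)) \<le> norm (B / m * inverse (1 + y\<^sup>2))"
    proof (rule AE_I2)
      fix y
      let ?z = "Complex c y"
      have nz: "?z \<notin> \<int>\<^sub>\<le>\<^sub>0" "?z + 1 \<notin> \<int>\<^sub>\<le>\<^sub>0"
        using c Complex_notin_nonpos_Ints[of c y] Complex_notin_nonpos_Ints[of "c + 1" y]
        by (simp_all add: Complex_eq add_ac)
      have "Complex (c + 2) y = ?z + 1 + 1"
        by (simp add: Complex_eq)
      then have "Gamma (Complex (c + 2) y) = (?z + 1) * (?z * Gamma ?z)"
        using Gamma_plus1[OF nz(1)] Gamma_plus1[OF nz(2)] by simp
      then have "norm (?z + 1) * norm ?z * norm (Gamma ?z) \<le> B"
        using B(2)[of y] by (simp add: norm_mult mult.assoc)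
      moreover have "m * (1 + y\<^sup>2) \<le> norm (?z + 1) * norm ?z"
      proof -
        have "norm ?z \<le> norm (?z + 1)"
          using c by (simp add: cmod_def power2_eq_square algebra_simps)
        then have "norm ?z * norm ?z \<le> norm (?z + 1) * norm ?z"
          by (intro mult_right_mono) auto
        moreover have "norm ?z * norm ?z = c\<^sup>2 + y\<^sup>2"
          by (simp add: cmod_def)
        moreover have "m * (1 + y\<^sup>2) \<le> c\<^sup>2 + y\<^sup>2"
          using mult_right_mono[of m 1 "y\<^sup>2"] by (simp add: m_def distrib_left)
        ultimately show ?thesis by simp
      qed
      ultimately have "m * (1 + y\<^sup>2) * norm (Gamma ?z) \<le> B"
        by (meson mult_right_mono norm_ge_zero order_trans)
      moreover have "1 + y\<^sup>2 > 0"
        by (simp add: add_pos_nonneg)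
      ultimately have "norm (Gamma ?z) \<le> B / (m * (1 + y\<^sup>2))"
        using m by (subst pos_le_divide_eq) (auto simp: mult.commute)
      then show "norm (Gamma ?z) \<le> norm (B / m * inverse (1 + y\<^sup>2))"
        by (simp add: divide_inverse mult_ac)
    qed
  qed (use borel_measurable_Gamma_Complex[OF c] in simp)
qed

section \<open>Inverse Mellin transforms of one and of two Gamma factors\<close>

text \<open>Here x is the logarithm of the Mellin variable X: after division by X^c the formula
  expresses e^(-X) through X^(-c-iy).\<close>

lemma Cahen_Mellin_integral:
  assumes c: "c > 0"
  shows "(LINT y|lborel. Gamma (Complex c y) * iexp (- (y * x)))
    = 2 * of_real pi * of_real (exp (c * x - exp x))"
\<comment> \<open>The exponent c v - e^v is largest at v = ln c, which gives B; the inequality 1 + u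
  \<le> e^u at u = v - ln c proves it.\<close>
proof (rule Fourier_inversion[where B = "exp (c * ln c - c)"])
  show "integrable lborel (\<lambda>v. complex_of_real (exp (c * v - exp v)))"
    using has_bochner_integral_Gamma_exp_scaled[OF c, of 1]
    by (simp add: has_bochner_integral_iff del: of_real_exp)
  show "norm (complex_of_real (exp (c * v - exp v))) \<le> exp (c * ln c - c)" for v
  proof -
    have "c * (1 + (v - ln c)) \<le> c * exp (v - ln c)"
      using c by (intro mult_left_mono exp_ge_add_one_self) auto
    also have "\<dots> = exp v"
      using c by (simp add: exp_diff)
    finally show ?thesis
      by (simp add: algebra_simps del: of_real_exp)
  qed
  show "isCont (\<lambda>v. complex_of_real (exp (c * v - exp v))) x"
    by (intro continuous_intros)
  show "Gamma (Complex c t) = (LINT v|lborel. of_real (exp (c * v - exp v)) * iexp (t * v))" for t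
  proof -
    have "of_real (exp (c * v - exp v)) * iexp (t * v)
        = exp (Complex c t * of_real v - of_real (exp v))" for v
      by (simp add: exp_of_real[symmetric] exp_add[symmetric] Complex_eq algebra_simps)
    then show ?thesis
      using has_bochner_integral_Gamma_exp[of "Complex c t"] c
      by (simp add: has_bochner_integral_iff)
  qed
  show "integrable lborel (\<lambda>y. Gamma (Complex c y))"
    by (rule integrable_Gamma_Complex[OF c])
qed

text \<open>Replace the second Gamma factor by Euler's integral over v and integrate over y first.
  The inner integral is the Cahen-Mellin integral at l + v; what remains is Euler's integral with
  exponent p + q and scale 1 + e^l.\<close>

lemma has_bochner_integral_Gamma_Gamma:
  assumes p: "p > 0" and q: "q > 0"
  shows "has_bochner_integral lborel
    (\<lambda>y. iexp (- (y * l)) * Gamma (Complex p y) * Gamma (Complex q (- y)))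
    (of_real (2 * pi * exp (p * l) * Gamma (p + q) * (1 + exp l) powr (- (p + q))))"
proof -
  note [measurable] = borel_measurable_Gamma_Complex[OF p]
  have [measurable]: "(\<lambda>y. Gamma (Complex q (- y))) \<in> borel_measurable borel"
    using measurable_compose[of uminus borel borel, OF _ borel_measurable_Gamma_Complex[OF q]] by simp
  obtain B where B: "\<And>y. norm (Gamma (Complex q y)) \<le> B"
    using norm_Gamma_Complex_bounded[OF q] by blast
  \<comment> \<open>The second Gamma factor is bounded on its line and the first is
    integrable.\<close>
  have int: "integrable lborel (\<lambda>y. iexp (- (y * l)) * Gamma (Complex p y) * Gamma (Complex q (- y)))"
  proof (rule Bochner_Integration.integrable_bound)
    show "integrable lborel (\<lambda>y. of_real B * Gamma (Complex p y))"
      using integrable_Gamma_Complex[OF p] by simp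
    show "AE y in lborel. norm (iexp (- (y * l)) * Gamma (Complex p y) * Gamma (Complex q (- y)))
        \<le> norm (of_real B * Gamma (Complex p y))"
      by (intro AE_I2, simp add: norm_mult mult.commute[of "\<bar>B\<bar>"])
        (intro mult_left_mono order_trans[OF B], auto)
  qed measurable
  let ?h = "\<lambda>v y. iexp (- (y * l)) * Gamma (Complex p y) * exp (Complex q (- y) * of_real v - of_real (exp v))"
  have "(LINT y|lborel. iexp (- (y * l)) * Gamma (Complex p y) * Gamma (Complex q (- y)))
      = (LINT y|lborel. LINT v|lborel. ?h v y)"
    using has_bochner_integral_Gamma_exp[of "Complex q (- y)" for y] q
    by (simp add: has_bochner_integral_iff)
  also have "\<dots> = (LINT v|lborel. LINT y|lborel. ?h v y)"
  proof (rule lborel_pair.Fubini_integral, rule integrable_lborel_pair_bound)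
    show "integrable lborel (\<lambda>v. complex_of_real (exp (q * v - exp v)))"
      using has_bochner_integral_Gamma_exp_scaled[OF q, of 1]
      by (simp add: has_bochner_integral_iff del: of_real_exp)
    show "integrable lborel (\<lambda>y. Gamma (Complex p y))"
      by (rule integrable_Gamma_Complex[OF p])
    show "(\<lambda>(v, y). ?h v y) \<in> borel_measurable (lborel \<Otimes>\<^sub>M lborel)"
      unfolding Complex_eq[of q] by measurable
    show "norm (case (v, y) of (v, y) \<Rightarrow> ?h v y)
        \<le> norm (complex_of_real (exp (q * v - exp v))) * norm (Gamma (Complex p y))" for v y
      by (simp add: norm_mult norm_exp_eq_Re del: of_real_exp)
  qed
  also have "\<dots> = (LINT v|lborel. of_real (2 * pi * exp (p * l)) *
      of_real (exp ((p + q) * v - (1 + exp l) * exp v)))"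
  proof (rule Bochner_Integration.integral_cong)
    fix v
    \<comment> \<open>The oscillating part of Euler's integrand merges with the phase at l, leaving
      a positive weight in v.\<close>
    have "?h v y = of_real (exp (q * v - exp v)) * (Gamma (Complex p y) * iexp (- (y * (l + v))))" for y
    proof -
      have "iexp (- (y * l)) * exp (Complex q (- y) * of_real v - of_real (exp v))
          = of_real (exp (q * v - exp v)) * iexp (- (y * (l + v)))"
        by (simp add: exp_of_real[symmetric] exp_add[symmetric] Complex_eq algebra_simps)
      then show ?thesis
        by (simp only: mult_ac)
    qed
    then have "(LINT y|lborel. ?h v y)
        = of_real (exp (q * v - exp v)) * (2 * of_real pi * of_real (exp (p * (l + v) - exp (l + v))))"
      by (simp only: integral_mult_right_zero Cahen_Mellin_integral[OF p])
    also have "\<dots> = of_real (2 * pi * (exp (q * v - exp v) * exp (p * (l + v) - exp (l + v))))"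
      by (simp del: of_real_exp)
    \<comment> \<open>The double exponentials combine because e^v + e^(l + v) = (1 + e^l)
      e^v.\<close>
    also have "exp (q * v - exp v) * exp (p * (l + v) - exp (l + v))
        = exp (p * l) * exp ((p + q) * v - (1 + exp l) * exp v)"
      by (simp add: exp_add[symmetric] algebra_simps)
    finally show "(LINT y|lborel. ?h v y) = of_real (2 * pi * exp (p * l)) *
        of_real (exp ((p + q) * v - (1 + exp l) * exp v))"
      by (simp del: of_real_exp)
  qed simp
  also have "\<dots> = of_real (2 * pi * exp (p * l)) * of_real (Gamma (p + q) * (1 + exp l) powr (- (p + q)))"
    using has_bochner_integral_Gamma_exp_scaled[of "p + q" "1 + exp l"] p q
    by (simp add: has_bochner_integral_iff add_pos_pos del: of_real_exp of_real_mult)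
  finally show ?thesis
    using int by (simp add: has_bochner_integral_iff mult.assoc)
qed

section \<open>Assembling the integral representation\<close>

theorem mainTheorem14:
  fixes \<alpha> \<beta> r :: complex and n :: nat and s x a :: real
  assumes "\<beta> \<noteq> 0" and "s \<ge> 0" and "0 < x" and "x < 1" and "0 < a" and "a < 1"
  defines "F \<equiv> \<lambda>t::complex. gen_factorial (r - \<beta> * t) \<alpha> n * of_real x powr (- t)
                              * Gamma t * Gamma (of_real s + 1 - t)"
  shows "vertical_integrable a F \<and>
         1 / of_real ((1 + x) powr (s + 1))
           * gen_geom_poly n (of_real s + 1) (of_real (- x / (1 + x))) \<alpha> \<beta> r
         = 1 / (2 * of_real pi * \<i> * Gamma (of_real s + 1)) * vertical_integral a F"
proof -
  define l where "l = ln x"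
  have x: "x = exp l"
    using \<open>0 < x\<close> by (simp add: l_def)
  define c where "c k = gen_stirling n k \<alpha> \<beta> r * (- \<beta>) ^ k" for k
  define I where "I k y = iexp (- (y * l)) * Gamma (Complex (a + real k) y) * Gamma (Complex (s + 1 - a) (- y))"
    for k y
  have F_eq: "F (Complex a y) = of_real (exp (- a * l)) * (\<Sum>k\<le>n. c k * I k y)" for y
  proof -
    let ?t = "Complex a y"
    \<comment> \<open>Each rising factorial of the Newton expansion is absorbed by Gamma(t),
      shifting the line from a to a + k.\<close>
    have poch: "pochhammer ?t k * Gamma ?t = Gamma (Complex (a + real k) y)" for k
    proof -
      have "?t + of_nat k = Complex (a + real k) y"
        by (simp add: complex_eq_iff)
      then show ?thesis
        using pochhammer_Gamma[of ?t k] Complex_notin_nonpos_Ints[OF \<open>0 < a\<close>, of y]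
        by (simp add: Gamma_eq_zero_iff)
    qed
    have "of_real x powr (- ?t) = of_real (exp (- a * l)) * iexp (- (y * l))"
    proof -
      have "of_real x powr (- ?t) = exp (- ?t * of_real l)"
        using \<open>0 < x\<close> by (simp add: powr_def Ln_of_real l_def)
      then show ?thesis
        by (simp add: exp_of_real[symmetric] exp_add[symmetric] Complex_eq algebra_simps)
    qed
    moreover have "of_real s + 1 - ?t = Complex (s + 1 - a) (- y)"
      by (simp add: complex_eq_iff)
    ultimately show ?thesis
      by (simp add: F_def I_def c_def gen_factorial_eq_sum_pochhammer[OF \<open>\<beta> \<noteq> 0\<close>]
          poch[symmetric] sum_distrib_left sum_distrib_right mult_ac del: of_real_exp)
  qed
  have "has_bochner_integral lborel (\<lambda>y. F (Complex a y)) (of_real (exp (- a * l)) *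
      (\<Sum>k\<le>n. c k * of_real (2 * pi * exp ((a + real k) * l) * Gamma (s + 1 + real k)
        * (1 + exp l) powr (- (s + 1 + real k)))))"
    unfolding F_eq
  proof (intro has_bochner_integral_mult_right has_bochner_integral_sum)
    fix k
    \<comment> \<open>Take p = a + k and q = s + 1 - a. Both are positive since 0 < a < 1 and s
      \<ge> 0, and a cancels from p + q.\<close>
    show "has_bochner_integral lborel (I k) (of_real (2 * pi * exp ((a + real k) * l) *
        Gamma (s + 1 + real k) * (1 + exp l) powr (- (s + 1 + real k))))"
      using has_bochner_integral_Gamma_Gamma[of "a + real k" "s + 1 - a" l]
        \<open>0 < a\<close> \<open>a < 1\<close> \<open>s \<ge> 0\<close>
      unfolding I_def by (simp add: algebra_simps)
  qed
  moreover have "of_real (exp (- a * l)) *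
      (\<Sum>k\<le>n. c k * of_real (2 * pi * exp ((a + real k) * l) * Gamma (s + 1 + real k)
        * (1 + exp l) powr (- (s + 1 + real k))))
     = 2 * of_real pi * Gamma (of_real s + 1) / of_real ((1 + x) powr (s + 1))
           * gen_geom_poly n (of_real s + 1) (of_real (- x / (1 + x))) \<alpha> \<beta> r"
  proof -
    \<comment> \<open>The factor x^(-a) cancels against x^(a + k), so the value does not depend on
      the chosen line.\<close>
    have term_eq: "exp (- a * l) * (2 * pi * exp ((a + real k) * l) * Gamma (s + 1 + real k)
        * (1 + exp l) powr (- (s + 1 + real k)))
      = 2 * pi * Gamma (s + 1) / (1 + x) powr (s + 1) * (pochhammer (s + 1) k * (x / (1 + x)) ^ k)" for k
    proof -
      have "s + 1 \<notin> \<int>\<^sub>\<le>\<^sub>0"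
        using \<open>s \<ge> 0\<close> by (auto elim!: nonpos_Ints_cases)
      then have "Gamma (s + 1 + real k) = pochhammer (s + 1) k * Gamma (s + 1)"
        by (simp add: pochhammer_Gamma Gamma_eq_zero_iff)
      moreover have "exp (- a * l) * exp ((a + real k) * l) = x ^ k"
        by (simp add: x exp_add[symmetric] exp_of_nat_mult[symmetric] algebra_simps)
      moreover have "(1 + exp l) powr (- (s + 1 + real k)) = 1 / ((1 + x) powr (s + 1) * (1 + x) ^ k)"
        using \<open>0 < x\<close> by (simp only: x[symmetric] powr_minus powr_add powr_realpow divide_inverse)
      ultimately show ?thesis
        by (simp add: power_divide mult_ac)
    qed
    have "of_real (exp (- a * l)) *
      (\<Sum>k\<le>n. c k * of_real (2 * pi * exp ((a + real k) * l) * Gamma (s + 1 + real k)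
        * (1 + exp l) powr (- (s + 1 + real k))))
      = (\<Sum>k\<le>n. c k * of_real (exp (- a * l) * (2 * pi * exp ((a + real k) * l) * Gamma (s + 1 + real k)
        * (1 + exp l) powr (- (s + 1 + real k)))))"
      by (simp only: sum_distrib_left of_real_mult mult_ac)
    also have "\<dots> = (\<Sum>k\<le>n. of_real (2 * pi * Gamma (s + 1) / (1 + x) powr (s + 1))
        * (c k * of_real (pochhammer (s + 1) k * (x / (1 + x)) ^ k)))"
      unfolding term_eq of_real_mult by (simp only: mult_ac)
    also have "\<dots> = of_real (2 * pi * Gamma (s + 1) / (1 + x) powr (s + 1))
           * gen_geom_poly n (of_real s + 1) (of_real (- x / (1 + x))) \<alpha> \<beta> r"
    proof -
      have "c k * of_real (pochhammer (s + 1) k * (x / (1 + x)) ^ k)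
        = gen_stirling n k \<alpha> \<beta> r * pochhammer (of_real s + 1) k * \<beta> ^ k * of_real (- x / (1 + x)) ^ k" for k
      proof -
        \<comment> \<open>The sign of -\<beta> moves into the argument -x/(1 + x) of the
          polynomial.\<close>
        have "(- \<beta>) ^ k * of_real (x / (1 + x)) ^ k = \<beta> ^ k * of_real (- x / (1 + x)) ^ k"
          unfolding power_mult_distrib[symmetric] by simp
        then show ?thesis
          by (simp add: c_def pochhammer_of_real[symmetric] mult_ac)
      qed
      then show ?thesis
        by (simp only: sum_distrib_left gen_geom_poly_def)
    qed
    finally show ?thesis
      by (simp add: Gamma_complex_of_real[symmetric])
  qed
  ultimately have "has_bochner_integral lborel (\<lambda>y. F (Complex a y))
    (2 * of_real pi * Gamma (of_real s + 1) / of_real ((1 + x) powr (s + 1))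
           * gen_geom_poly n (of_real s + 1) (of_real (- x / (1 + x))) \<alpha> \<beta> r)"
    by simp
  \<comment> \<open>Needed to divide by Gamma(s + 1); the i in the prefactor cancels against the i
    from dt = i dy.\<close>
  moreover have "Gamma (of_real s + 1 :: complex) \<noteq> 0"
    using Complex_notin_nonpos_Ints[of "s + 1" 0] \<open>s \<ge> 0\<close>
    by (simp add: Gamma_eq_zero_iff Complex_eq)
  ultimately show ?thesis
    by (simp add: vertical_integrable_def vertical_integral_def has_bochner_integral_iff)
qed

end
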